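(* (i) Let $p\in(0,\infty)\setminus2\mathbb{N}$. The smallest $n\in\mathbb{N}$ such that $\phi_p[A]\notin\mathbb{P}_n$ for at least one matrix $A\in\mathbb{P}_n$ is $n=\lfloor p\rfloor+3$. (ii) Let $p\in(0,\infty)\setminus(-1+2\mathbb{N})$. The smallest $n\in\mathbb{N}$ such that $\psi_p[A]\notin\mathbb{P}_n$ for at least one matrix $A\in\mathbb{P}_n$ is $n=\lfloor p\rfloor+3$.
   Context: $\mathbb{N}=\{1,2,3,\dots\}$; $2\mathbb{N}$ and $-1+2\mathbb{N}$ are the positive even and positive odd integers. $\mathbb{P}_n$ is the set of real symmetric positive semidefinite $n\times n$ matrices. For $p>0$, $\phi_p(x):=|x|^p$ and $\psi_p(x):=\operatorname{sign}(x)|x|^p$ for $x\in\mathbb{R}\setminus\{0\}$, and $\phi_p(0)=\psi_p(0)=0$. For a function $f$ and a matrix $A=(a_{ij})$, $f[A]:=(f(a_{ij}))$ (entrywise application). *)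

theory Defs
  imports Complex_Main "Jordan_Normal_Form.Matrix"
begin

definition psd_mats :: "nat \<Rightarrow> real mat set" where
  "psd_mats n = {A \<in> carrier_mat n n.
     transpose_mat A = A \<and> (\<forall>v \<in> carrier_vec n. v \<bullet> (A *\<^sub>v v) \<ge> 0)}"

(* The value at 0 is 0 in both definitions, because 0 powr p = 0 for every real p. *)

definition phi :: "real \<Rightarrow> real \<Rightarrow> real" where
  "phi p x = \<bar>x\<bar> powr p"

definition psi :: "real \<Rightarrow> real \<Rightarrow> real" where
  "psi p x = sgn x * \<bar>x\<bar> powr p"

definition is_least :: "nat \<Rightarrow> nat set \<Rightarrow> bool" where
  "is_least n S \<longleftrightarrow> n \<in> S \<and> (\<forall>m \<in> S. n \<le> m)"

end

theory Submission
  imports Defs "HOL-Analysis.Generalised_Binomial_Theorem" "HOL-Computational_Algebra.Polynomial"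
begin

text \<open>For sizes up to \<open>p + 2\<close> positivity is preserved, by induction on the size (after FitzGerald
  and Horn). Split \<open>A = B + C\<close> with \<open>B\<close> of rank one and \<open>C\<close> a Schur complement, whose \<open>k\<close>-th row
  and column vanish. The function \<open>f[B + t C]\<close> has derivative \<open>f'[B + t C] \<circ> C\<close>, a Schur product
  that lives on one index fewer; since differentiation exchanges \<open>phi p\<close> and \<open>psi p\<close> with
  \<open>p psi (p - 1)\<close> and \<open>p phi (p - 1)\<close>, it is positive by induction, and \<open>f[B]\<close> has rank one because
  \<open>f\<close> is multiplicative. Above this size, failure is witnessed by \<open>(1 + e s\<^sub>i s\<^sub>j)\<close>: with small
  \<open>e\<close> and positive nodes when \<open>p\<close> is not an integer, because the binomial coefficient of order
  \<open>\<lfloor>p\<rfloor> + 2\<close> is negative, and with \<open>e = 1\<close> and exactly one negative off-diagonal pair when \<open>p\<close>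
  is an integer of the wrong parity.\<close>

subsection \<open>Positive semidefinite kernels\<close>

text \<open>Kernels on arbitrary index sets let an index be dropped without renumbering and let real
  nodes serve as indices. Symmetry is a separate clause because the quadratic form sees only the
  symmetric part.\<close>

definition psd_on :: "'a set \<Rightarrow> ('a \<Rightarrow> 'a \<Rightarrow> real) \<Rightarrow> bool" where
  "psd_on I a \<longleftrightarrow> (\<forall>i\<in>I. \<forall>j\<in>I. a i j = a j i) \<and>
     (\<forall>x. 0 \<le> (\<Sum>i\<in>I. \<Sum>j\<in>I. x i * x j * a i j))"

lemma psd_onI:
  assumes "\<And>i j. i \<in> I \<Longrightarrow> j \<in> I \<Longrightarrow> a i j = a j i"
    and "\<And>x. 0 \<le> (\<Sum>i\<in>I. \<Sum>j\<in>I. x i * x j * a i j)"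
  shows "psd_on I a"
  using assms unfolding psd_on_def by blast

lemma psd_on_sym: "psd_on I a \<Longrightarrow> i \<in> I \<Longrightarrow> j \<in> I \<Longrightarrow> a i j = a j i"
  unfolding psd_on_def by blast

lemma psd_on_nonneg: "psd_on I a \<Longrightarrow> 0 \<le> (\<Sum>i\<in>I. \<Sum>j\<in>I. x i * x j * a i j)"
  unfolding psd_on_def by blast

lemma psd_on_cong:
  assumes "psd_on I a" "\<And>i j. i \<in> I \<Longrightarrow> j \<in> I \<Longrightarrow> a i j = b i j"
  shows "psd_on I b"
  using assms unfolding psd_on_def by simp

lemma psd_on_subset:
  assumes "psd_on I a" "finite I" "J \<subseteq> I"
  shows "psd_on J a"
proof (rule psd_onI)
  show "a i j = a j i" if "i \<in> J" "j \<in> J" for i j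
    using psd_on_sym[OF assms(1)] assms(3) that by (meson subsetD)
  fix x :: "'a \<Rightarrow> real"
  define y where "y i = (if i \<in> J then x i else 0)" for i
  have "(\<Sum>i\<in>I. \<Sum>j\<in>I. y i * y j * a i j) = (\<Sum>i\<in>J. \<Sum>j\<in>J. y i * y j * a i j)"
    using assms(2,3)
    by (intro sum.mono_neutral_cong_right sum.mono_neutral_cong_right)
       (auto simp: y_def intro!: sum.mono_neutral_cong_right)
  also have "\<dots> = (\<Sum>i\<in>J. \<Sum>j\<in>J. x i * x j * a i j)"
    by (simp add: y_def)
  finally show "0 \<le> (\<Sum>i\<in>J. \<Sum>j\<in>J. x i * x j * a i j)"
    using psd_on_nonneg[OF assms(1), of y] by simp
qed

section \<open>Two-by-two minors\<close>

lemma psd_on_two_points: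
  assumes "psd_on I a" "finite I" "i \<in> I" "j \<in> I" "i \<noteq> j"
  shows "0 \<le> s\<^sup>2 * a i i + 2 * (s * t * a i j) + t\<^sup>2 * a j j"
proof -
  have "psd_on {i, j} a"
    using assms(3,4) by (intro psd_on_subset[OF assms(1,2)]) auto
  from psd_on_nonneg[OF this, of "\<lambda>m. if m = i then s else t"]
  have "0 \<le> s * s * a i i + s * t * a i j + (t * s * a j i + t * t * a j j)"
    using assms(5) by simp
  moreover have "a j i = a i j"
    using psd_on_sym[OF assms(1,4,3)] .
  ultimately show ?thesis
    by (simp add: power2_eq_square algebra_simps)
qed

lemma psd_on_diag:
  assumes "psd_on I a" "finite I" "i \<in> I"
  shows "0 \<le> a i i"
proof -
  have "psd_on {i} a"
    using assms(3) by (intro psd_on_subset[OF assms(1,2)]) auto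
  from psd_on_nonneg[OF this, of "\<lambda>_. 1"] show ?thesis by simp
qed

text \<open>The test vector \<open>(a j j, - a i j)\<close> turns the two-point form into
  \<open>a j j\<close> times the minor. If \<open>a j j = 0\<close>, the form at
  \<open>s = 1\<close> is affine in \<open>t\<close>, hence nonnegative only if
  \<open>a i j = 0\<close>.\<close>

lemma psd_on_minor:
  assumes "psd_on I a" "finite I" "i \<in> I" "j \<in> I"
  shows "(a i j)\<^sup>2 \<le> a i i * a j j"
proof (cases "i = j")
  case False
  note two = psd_on_two_points[OF assms False]
  note dj = psd_on_diag[OF assms(1,2,4)]
  show ?thesis
  proof (cases "a j j = 0")
    case True
    have "a i j = 0"
    proof (rule ccontr)
      assume "a i j \<noteq> 0"
      \<comment> \<open>This \<open>t\<close> would make the form equal to -1.\<close>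
      moreover have "0 \<le> a i i + 2 * (((- a i i - 1) / (2 * a i j)) * a i j)"
        using two[of 1 "(- a i i - 1) / (2 * a i j)"] True by simp
      ultimately show False by (simp add: field_simps)
    qed
    then show ?thesis using True by simp
  next
    case nz: False
    have "0 \<le> (a j j)\<^sup>2 * a i i + 2 * (a j j * (- a i j) * a i j) + (- a i j)\<^sup>2 * a j j"
      by (rule two)
    also have "\<dots> = a j j * (a i i * a j j - (a i j)\<^sup>2)"
      by (simp add: power2_eq_square algebra_simps)
    finally show ?thesis
      using nz dj by (simp add: zero_le_mult_iff)
  qed
qed (simp add: power2_eq_square)

text \<open>The arithmetic-geometric mean inequality bounds the cross term by the diagonal terms.
  Allowing \<open>i = j\<close> covers singletons.\<close>

lemma psd_on_two_point_set:
  assumes "a i j = a j i" "0 \<le> a i i" "0 \<le> a j j" "(a i j)\<^sup>2 \<le> a i i * a j j"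
  shows "psd_on {i, j} a"
proof (cases "i = j")
  case True
  then show ?thesis using assms by (intro psd_onI) auto
next
  case False
  show ?thesis
  proof (rule psd_onI)
    fix x :: "'a \<Rightarrow> real"
    have "(x i * x j * a i j)\<^sup>2 = (x i)\<^sup>2 * (x j)\<^sup>2 * (a i j)\<^sup>2"
      by (simp add: power_mult_distrib)
    also have "\<dots> \<le> (x i)\<^sup>2 * (x j)\<^sup>2 * (a i i * a j j)"
      using assms(4) by (intro mult_left_mono) auto
    also have "\<dots> = ((x i)\<^sup>2 * a i i) * ((x j)\<^sup>2 * a j j)" by simp
    finally have "\<bar>x i * x j * a i j\<bar> \<le> sqrt (((x i)\<^sup>2 * a i i) * ((x j)\<^sup>2 * a j j))"
      by (rule real_le_rsqrt[of "\<bar>_\<bar>", simplified])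
    also have "\<dots> \<le> ((x i)\<^sup>2 * a i i + (x j)\<^sup>2 * a j j) / 2"
      using assms by (intro arith_geo_mean_sqrt) auto
    finally show "0 \<le> (\<Sum>m\<in>{i, j}. \<Sum>n\<in>{i, j}. x m * x n * a m n)"
      using False assms(1) by (simp add: power2_eq_square algebra_simps abs_le_iff)
  qed (use assms in auto)
qed

section \<open>Closure properties and Schur complements\<close>

lemma psd_on_rank_one:
  assumes "0 \<le> c"
  shows "psd_on I (\<lambda>i j. z i * z j / c)"
proof (rule psd_onI)
  fix x :: "'a \<Rightarrow> real"
  have "(\<Sum>i\<in>I. \<Sum>j\<in>I. x i * x j * (z i * z j / c)) = (\<Sum>i\<in>I. x i * z i)\<^sup>2 / c"
    by (simp add: power2_eq_square sum_product sum_divide_distrib algebra_simps)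
  then show "0 \<le> (\<Sum>i\<in>I. \<Sum>j\<in>I. x i * x j * (z i * z j / c))"
    using assms by simp
qed simp

lemma psd_on_add:
  assumes "psd_on I a" "psd_on I b"
  shows "psd_on I (\<lambda>i j. a i j + b i j)"
proof (rule psd_onI)
  show "a i j + b i j = a j i + b j i" if "i \<in> I" "j \<in> I" for i j
    using assms that by (simp add: psd_on_sym)
  show "0 \<le> (\<Sum>i\<in>I. \<Sum>j\<in>I. x i * x j * (a i j + b i j))" for x
    using psd_on_nonneg[OF assms(1), of x] psd_on_nonneg[OF assms(2), of x]
    by (simp add: distrib_left sum.distrib)
qed

lemma psd_on_scale:
  assumes "psd_on I a" "0 \<le> c"
  shows "psd_on I (\<lambda>i j. c * a i j)"
proof (rule psd_onI)
  show "c * a i j = c * a j i" if "i \<in> I" "j \<in> I" for i j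
    using assms that by (simp add: psd_on_sym)
  fix x :: "'a \<Rightarrow> real"
  have "(\<Sum>i\<in>I. \<Sum>j\<in>I. x i * x j * (c * a i j)) = c * (\<Sum>i\<in>I. \<Sum>j\<in>I. x i * x j * a i j)"
    by (simp add: sum_distrib_left algebra_simps)
  then show "0 \<le> (\<Sum>i\<in>I. \<Sum>j\<in>I. x i * x j * (c * a i j))"
    using assms(2) psd_on_nonneg[OF assms(1), of x] by simp
qed

text \<open>If \<open>a k k = 0\<close> then the whole \<open>k\<close>-th row vanishes, so the junk value \<open>x / 0 = 0\<close> is the
  right one.\<close>

lemma psd_on_Schur_complement:
  assumes a: "psd_on I a" and fin: "finite I" and k: "k \<in> I"
  defines "c \<equiv> \<lambda>i j. a i j - a i k * a j k / a k k"
  shows "psd_on I c" and "\<And>i. i \<in> I \<Longrightarrow> c i k = 0" and "\<And>i. i \<in> I \<Longrightarrow> c k i = 0"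
proof -
  have row: "a i k = 0" if "a k k = 0" "i \<in> I" for i
    using psd_on_minor[OF a fin that(2) k] that(1) by simp
  show c0: "c i k = 0" if "i \<in> I" for i
    using row[OF _ that] unfolding c_def by auto
  have sym: "c i j = c j i" if "i \<in> I" "j \<in> I" for i j
    using psd_on_sym[OF a that] unfolding c_def by (simp add: mult.commute)
  then show "c k i = 0" if "i \<in> I" for i
    using c0[OF that] k that by simp
  show "psd_on I c"
  proof (rule psd_onI)
    show "c i j = c j i" if "i \<in> I" "j \<in> I" for i j
      using sym that .
    fix x :: "'a \<Rightarrow> real"
    define l where "l = (\<Sum>i\<in>I. x i * a i k)"
    \<comment> \<open>Completing the square: for \<open>a k k > 0\<close> this choice minimises the
      form of \<open>a\<close> over the \<open>k\<close>-th coordinate, and the minimum is the form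
      of \<open>c\<close> at \<open>x\<close>.\<close>
    define y where "y i = x i - (if i = k then l / a k k else 0)" for i
    have yk: "(\<Sum>i\<in>I. y i * g i) = (\<Sum>i\<in>I. x i * g i) - l / a k k * g k" for g
      using k fin
      by (simp add: y_def left_diff_distrib sum_subtractf if_distrib[of "\<lambda>u. u * _"] cong: if_cong)
    have "(\<Sum>i\<in>I. \<Sum>j\<in>I. y i * y j * a i j) = (\<Sum>i\<in>I. y i * (\<Sum>j\<in>I. y j * a i j))"
      by (simp add: sum_distrib_left algebra_simps)
    also have "\<dots> = (\<Sum>i\<in>I. x i * (\<Sum>j\<in>I. x j * a i j)) - l / a k k * (\<Sum>i\<in>I. x i * a i k)
        - l / a k k * ((\<Sum>j\<in>I. x j * a k j) - l / a k k * a k k)"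
      unfolding yk by (simp add: right_diff_distrib sum_subtractf sum_distrib_left algebra_simps)
    also have "(\<Sum>j\<in>I. x j * a k j) = l"
      unfolding l_def using psd_on_sym[OF a k] by simp
    also have "(\<Sum>i\<in>I. x i * a i k) = l"
      by (simp add: l_def)
    \<comment> \<open>The last product vanishes either way: its bracket is 0 if \<open>a k k\<close>
      is nonzero, and otherwise \<open>l / a k k\<close> is 0 by convention.\<close>
    also have "(\<Sum>i\<in>I. x i * (\<Sum>j\<in>I. x j * a i j)) - l / a k k * l - l / a k k * (l - l / a k k * a k k)
        = (\<Sum>i\<in>I. x i * (\<Sum>j\<in>I. x j * a i j)) - l * l / a k k"
      by simp
    also have "\<dots> = (\<Sum>i\<in>I. \<Sum>j\<in>I. x i * x j * c i j)"
      by (simp add: l_def c_def right_diff_distrib sum_subtractf sum_distrib_left sum_product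
          sum_divide_distrib algebra_simps)
    finally show "0 \<le> (\<Sum>i\<in>I. \<Sum>j\<in>I. x i * x j * c i j)"
      using psd_on_nonneg[OF a, of y] by simp
  qed
qed

section \<open>Schur products\<close>

lemma sum_sum_vanishing_row:
  fixes g :: "'a \<Rightarrow> 'a \<Rightarrow> real"
  assumes "finite J" "\<And>i. i \<in> insert k J \<Longrightarrow> g i k = 0" "\<And>i. i \<in> insert k J \<Longrightarrow> g k i = 0"
  shows "(\<Sum>i\<in>insert k J. \<Sum>j\<in>insert k J. g i j) = (\<Sum>i\<in>J. \<Sum>j\<in>J. g i j)"
  using assms by (cases "k \<in> J") (simp_all add: insert_absorb)

text \<open>The rank-one part of \<open>a\<close> contributes the form of \<open>b\<close> at the
  vector \<open>x i * a i k\<close>, divided by \<open>a k k\<close>; the Schur complement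
  contributes a form on \<open>J\<close> only.\<close>

theorem Schur_product:
  assumes "finite I" "psd_on I a" "psd_on I b"
  shows "psd_on I (\<lambda>i j. a i j * b i j)"
  using assms
proof (induction I arbitrary: a rule: finite_induct)
  case empty
  show ?case by (simp add: psd_on_def)
next
  case (insert k J)
  let ?I = "insert k J"
  define c where "c i j = a i j - a i k * a j k / a k k" for i j
  have fin: "finite ?I" using insert by simp
  note C = psd_on_Schur_complement[OF insert.prems(1) fin insertI1, folded c_def]
  have "psd_on J (\<lambda>i j. c i j * b i j)"
    by (intro insert.IH psd_on_subset[OF C(1) fin] psd_on_subset[OF insert.prems(2) fin]) auto
  then have 1: "0 \<le> (\<Sum>i\<in>J. \<Sum>j\<in>J. x i * x j * (c i j * b i j))" for x
    by (rule psd_on_nonneg)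
  show ?case
  proof (rule psd_onI)
    show "a i j * b i j = a j i * b j i" if "i \<in> ?I" "j \<in> ?I" for i j
      using psd_on_sym[OF insert.prems(1) that] psd_on_sym[OF insert.prems(2) that] by simp
    fix x :: "'a \<Rightarrow> real"
    have "(\<Sum>i\<in>?I. \<Sum>j\<in>?I. x i * x j * (a i j * b i j))
        = (\<Sum>i\<in>?I. \<Sum>j\<in>?I. (x i * a i k) * (x j * a j k) * b i j) / a k k
          + (\<Sum>i\<in>?I. \<Sum>j\<in>?I. x i * x j * (c i j * b i j))"
      unfolding sum_divide_distrib sum.distrib[symmetric]
      by (intro sum.cong refl) (simp add: c_def algebra_simps)
    also have "(\<Sum>i\<in>?I. \<Sum>j\<in>?I. x i * x j * (c i j * b i j))
        = (\<Sum>i\<in>J. \<Sum>j\<in>J. x i * x j * (c i j * b i j))"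
      using C insert.hyps by (intro sum_sum_vanishing_row) auto
    finally show "0 \<le> (\<Sum>i\<in>?I. \<Sum>j\<in>?I. x i * x j * (a i j * b i j))"
      using 1[of x] psd_on_nonneg[OF insert.prems(2), of "\<lambda>i. x i * a i k"]
        psd_on_diag[OF insert.prems(1) fin insertI1] by simp
  qed
qed

text \<open>The inductive step. Multiplicativity is stated with a quotient to match the entries of
  the rank-one part, including the degenerate case \<open>a k k = 0\<close>.\<close>

lemma psd_on_insert_by_derivative:
  assumes fin: "finite J" and a: "psd_on (insert k J) a"
    and mult: "\<And>x y z. f (x * y / z) = f x * f y / (f z :: real)"
    and nonneg: "\<And>x. 0 \<le> x \<Longrightarrow> 0 \<le> f x"
    and deriv: "\<And>x. (f has_real_derivative f' x) (at x)"
    and f': "\<And>b. psd_on J b \<Longrightarrow> psd_on J (\<lambda>i j. f' (b i j))"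
  shows "psd_on (insert k J) (\<lambda>i j. f (a i j))"
proof (rule psd_onI)
  let ?I = "insert k J"
  have finI: "finite ?I" using fin by simp
  show "f (a i j) = f (a j i)" if "i \<in> ?I" "j \<in> ?I" for i j
    using psd_on_sym[OF a that] by simp
  fix x :: "'a \<Rightarrow> real"
  define b where "b i j = a i k * a j k / a k k" for i j
  define c where "c i j = a i j - a i k * a j k / a k k" for i j
  note C = psd_on_Schur_complement[OF a finI insertI1, folded c_def]
  define g where "g t = (\<Sum>i\<in>?I. \<Sum>j\<in>?I. x i * x j * f (b i j + t * c i j))" for t
  define g' where "g' t = (\<Sum>i\<in>?I. \<Sum>j\<in>?I. x i * x j * (f' (b i j + t * c i j) * c i j))" for t
  have akk: "0 \<le> a k k" using psd_on_diag[OF a finI] by simp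
  have "((\<lambda>t. f (b i j + t * c i j)) has_real_derivative f' (b i j + t * c i j) * c i j) (at t)"
    for i j t
    by (rule DERIV_chain'[OF _ deriv]) (auto intro!: derivative_eq_intros)
  then have g_deriv: "(g has_real_derivative g' t) (at t)" for t
    unfolding g_def g'_def by (intro DERIV_sum DERIV_cmult)
  have g'_nonneg: "0 \<le> g' t" if "0 \<le> t" for t
  proof -
    have "psd_on ?I (\<lambda>i j. b i j + t * c i j)"
      unfolding b_def
      by (rule psd_on_add[OF psd_on_rank_one[OF akk] psd_on_scale[OF C(1) that]])
    then have "psd_on J (\<lambda>i j. f' (b i j + t * c i j))"
      using f' psd_on_subset[OF _ finI subset_insertI] by simp
    moreover have "psd_on J c"
      by (intro psd_on_subset[OF C(1) finI]) auto
    ultimately have "psd_on J (\<lambda>i j. f' (b i j + t * c i j) * c i j)"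
      by (rule Schur_product[OF fin])
    \<comment> \<open>The factor \<open>c\<close> kills row and column \<open>k\<close>, so
      \<open>f'\<close> is needed on \<open>J\<close> only.\<close>
    moreover have "g' t = (\<Sum>i\<in>J. \<Sum>j\<in>J. x i * x j * (f' (b i j + t * c i j) * c i j))"
      unfolding g'_def using C fin by (intro sum_sum_vanishing_row) auto
    ultimately show ?thesis
      by (simp add: psd_on_nonneg)
  qed
  \<comment> \<open>By multiplicativity the kernel at \<open>t = 0\<close> is again of rank one,
    with vector \<open>f (a i k)\<close> and divisor \<open>f (a k k)\<close>.\<close>
  have "0 \<le> g 0"
    using psd_on_nonneg[OF psd_on_rank_one[OF nonneg[OF akk], of ?I "\<lambda>i. f (a i k)"], of x]
    by (simp add: g_def b_def mult)
  also have "g 0 \<le> g 1"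
    by (rule DERIV_nonneg_imp_nondecreasing) (use g_deriv g'_nonneg in auto)
  also have "g 1 = (\<Sum>i\<in>?I. \<Sum>j\<in>?I. x i * x j * f (a i j))"
    by (simp add: g_def b_def c_def)
  finally show "0 \<le> (\<Sum>i\<in>?I. \<Sum>j\<in>?I. x i * x j * f (a i j))" .
qed

text \<open>Symmetry and each inequality are closed conditions. This serves the exponent 1.\<close>

lemma psd_on_limit:
  fixes I :: "'a set"
  assumes "F \<noteq> bot" "\<forall>\<^sub>F q in F. psd_on I (a q)"
    and lim: "\<And>i j. ((\<lambda>q. a q i j) \<longlongrightarrow> b i j) F"
  shows "psd_on I b"
proof (rule psd_onI)
  fix i j assume ij: "i \<in> I" "j \<in> I"
  have "\<forall>\<^sub>F q in F. a q i j = a q j i"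
    using assms(2) by (rule eventually_mono) (use ij psd_on_sym in metis)
  then have "((\<lambda>q. a q j i) \<longlongrightarrow> b i j) F"
    using lim[of i j] by (rule Lim_transform_eventually[rotated])
  then show "b i j = b j i"
    using lim[of j i] assms(1) tendsto_unique by blast
next
  fix x :: "'a \<Rightarrow> real"
  have "((\<lambda>q. \<Sum>i\<in>I. \<Sum>j\<in>I. x i * x j * a q i j) \<longlongrightarrow> (\<Sum>i\<in>I. \<Sum>j\<in>I. x i * x j * b i j)) F"
    by (intro tendsto_sum tendsto_mult_left lim)
  moreover have "\<forall>\<^sub>F q in F. 0 \<le> (\<Sum>i\<in>I. \<Sum>j\<in>I. x i * x j * a q i j)"
    using assms(2) by (rule eventually_mono) (rule psd_on_nonneg)
  ultimately show "0 \<le> (\<Sum>i\<in>I. \<Sum>j\<in>I. x i * x j * b i j)"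
    using assms(1) by (rule tendsto_lowerbound)
qed

text \<open>Transports kernels indexed by real nodes to matrices; test vectors travel back along
  \<open>inv_into J h\<close>.\<close>

lemma psd_on_reindex:
  fixes a :: "'a \<Rightarrow> 'a \<Rightarrow> real"
  assumes "bij_betw h J I"
  shows "psd_on J (\<lambda>i j. a (h i) (h j)) \<longleftrightarrow> psd_on I a"
proof -
  have img: "I = h ` J" and inj: "inj_on h J"
    using assms by (auto simp: bij_betw_def)
  have form: "(\<Sum>i\<in>J. \<Sum>j\<in>J. x (h i) * x (h j) * a (h i) (h j)) = (\<Sum>i\<in>I. \<Sum>j\<in>I. x i * x j * a i j)"
    for x
    by (simp add: img sum.reindex[OF inj])
  have form': "(\<Sum>i\<in>J. \<Sum>j\<in>J. x i * x j * a (h i) (h j))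
      = (\<Sum>i\<in>I. \<Sum>j\<in>I. x (inv_into J h i) * x (inv_into J h j) * a i j)" for x
    unfolding form[symmetric] using inj by (intro sum.cong) auto
  show ?thesis
  proof
    assume psd: "psd_on J (\<lambda>i j. a (h i) (h j))"
    show "psd_on I a"
    proof (rule psd_onI)
      show "a i j = a j i" if "i \<in> I" "j \<in> I" for i j
        using that psd_on_sym[OF psd] by (auto simp: img)
      show "0 \<le> (\<Sum>i\<in>I. \<Sum>j\<in>I. x i * x j * a i j)" for x
        using psd_on_nonneg[OF psd, of "\<lambda>i. x (h i)"] by (simp only: form)
    qed
  next
    assume psd: "psd_on I a"
    show "psd_on J (\<lambda>i j. a (h i) (h j))"
    proof (rule psd_onI)
      show "a (h i) (h j) = a (h j) (h i)" if "i \<in> J" "j \<in> J" for i j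
        using that by (intro psd_on_sym[OF psd]) (auto simp: img)
      show "0 \<le> (\<Sum>i\<in>J. \<Sum>j\<in>J. x i * x j * a (h i) (h j))" for x
        unfolding form' by (rule psd_on_nonneg[OF psd])
    qed
  qed
qed

subsection \<open>Powers that preserve positivity\<close>

lemma phi_mult_divide: "phi p (x * y / z) = phi p x * phi p y / phi p z"
  by (simp add: phi_def abs_mult powr_mult powr_divide)

lemma psi_mult_divide: "psi p (x * y / z) = psi p x * psi p y / psi p z"
  by (simp add: psi_def sgn_mult sgn_divide abs_mult powr_mult powr_divide field_simps)
     (simp add: sgn_if)

section \<open>Derivatives of the power functions\<close>

lemma tendsto_abs_powr_0:
  assumes "0 < p"
  shows "((\<lambda>h::real. \<bar>h\<bar> powr p) \<longlongrightarrow> 0) (at 0)"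
proof -
  have "((\<lambda>h::real. \<bar>h\<bar>) \<longlongrightarrow> \<bar>0\<bar>) (at 0)"
    by (rule tendsto_rabs[OF tendsto_ident_at])
  then have "((\<lambda>h::real. \<bar>h\<bar> powr p) \<longlongrightarrow> \<bar>0\<bar> powr p) (at 0)"
    by (rule tendsto_powr'[OF _ tendsto_const]) (use assms in auto)
  then show ?thesis by simp
qed

text \<open>Within distance \<open>\<bar>x\<bar>\<close> of \<open>x\<close> the sign is constant,
  so the absolute value of \<open>y\<close> is \<open>sgn x * y\<close> there.\<close>

lemma DERIV_abs_powr_nonzero:
  fixes x :: real
  assumes "x \<noteq> 0"
  shows "((\<lambda>x. \<bar>x\<bar> powr p) has_real_derivative p * (sgn x * \<bar>x\<bar> powr (p - 1))) (at x)"
proof -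
  have "((\<lambda>y. (sgn x * y) powr p) has_real_derivative p * (sgn x * x) powr (p - 1) * sgn x) (at x)"
  proof (rule DERIV_chain'[where g = "\<lambda>z. z powr p"])
    show "((*) (sgn x) has_real_derivative sgn x) (at x)"
      by (auto intro!: derivative_eq_intros)
    show "((\<lambda>z. z powr p) has_real_derivative p * (sgn x * x) powr (p - 1)) (at (sgn x * x))"
      using assms by (intro has_real_derivative_powr) (auto simp: sgn_if)
  qed
  then have "((\<lambda>y. \<bar>y\<bar> powr p) has_real_derivative p * (sgn x * x) powr (p - 1) * sgn x) (at x)"
  proof (rule has_field_derivative_transform_within)
    show "0 < \<bar>x\<bar>" using assms by simp
    show "(sgn x * y) powr p = \<bar>y\<bar> powr p" if "dist y x < \<bar>x\<bar>" for y
      using that by (auto simp: dist_real_def sgn_if abs_if split: if_splits)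
  qed auto
  moreover have "sgn x * x = \<bar>x\<bar>"
    by (simp add: sgn_if abs_if)
  ultimately show ?thesis
    by (simp add: mult_ac)
qed

text \<open>At 0 the difference quotient is \<open>psi (p - 1) h\<close>, which tends to 0 because
  the exponent \<open>p - 1\<close> is positive.\<close>

lemma DERIV_phi:
  assumes "1 < p"
  shows "(phi p has_real_derivative p * psi (p - 1) x) (at x)"
proof (cases "x = 0")
  case True
  have "phi p h / h = psi (p - 1) h" if "h \<noteq> 0" for h
    using that by (simp add: phi_def psi_def powr_diff sgn_if)
  moreover have "((\<lambda>h. psi (p - 1) h) \<longlongrightarrow> 0) (at 0)"
    by (rule tendsto_rabs_zero_cancel, rule Lim_transform_eventually[OF tendsto_abs_powr_0[of "p - 1"]])
       (use assms in \<open>auto simp: psi_def abs_mult eventually_at_filter\<close>)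
  ultimately have "((\<lambda>h. phi p h / h) \<longlongrightarrow> 0) (at 0)"
    by (subst tendsto_cong[where g = "psi (p - 1)"]) (auto simp: eventually_at_filter)
  then show ?thesis
    using True assms by (simp add: has_field_derivative_iff phi_def psi_def)
next
  case False
  then show ?thesis
    using DERIV_abs_powr_nonzero[OF False] by (simp add: phi_def[abs_def] psi_def)
qed

lemma DERIV_psi:
  assumes "1 < p"
  shows "(psi p has_real_derivative p * phi (p - 1) x) (at x)"
proof (cases "x = 0")
  case True
  have "psi p h / h = phi (p - 1) h" if "h \<noteq> 0" for h
    using that by (simp add: phi_def psi_def powr_diff sgn_if)
  moreover have "((\<lambda>h. phi (p - 1) h) \<longlongrightarrow> 0) (at 0)"
    using assms unfolding phi_def by (intro tendsto_abs_powr_0) simp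
  ultimately have "((\<lambda>h. psi p h / h) \<longlongrightarrow> 0) (at 0)"
    by (subst tendsto_cong[where g = "phi (p - 1)"]) (auto simp: eventually_at_filter)
  then show ?thesis
    using True assms by (simp add: has_field_derivative_iff phi_def psi_def)
next
  case False
  have "((\<lambda>y. sgn x * \<bar>y\<bar> powr p) has_real_derivative
      sgn x * (p * (sgn x * \<bar>x\<bar> powr (p - 1)))) (at x)"
    by (intro DERIV_cmult DERIV_abs_powr_nonzero False)
  then have "(psi p has_real_derivative sgn x * (p * (sgn x * \<bar>x\<bar> powr (p - 1)))) (at x)"
  proof (rule has_field_derivative_transform_within)
    show "0 < \<bar>x\<bar>" using False by simp
    show "sgn x * \<bar>y\<bar> powr p = psi p y" if "dist y x < \<bar>x\<bar>" for y
      using that by (auto simp: psi_def dist_real_def sgn_if abs_if split: if_splits)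
  qed auto
  moreover have "sgn x * (p * (sgn x * \<bar>x\<bar> powr (p - 1))) = p * phi (p - 1) x"
    using False by (simp add: phi_def sgn_if)
  ultimately show ?thesis by simp
qed

text \<open>The map \<open>\<bar>x\<bar> powr p\<close> is multiplicative and monotone in
  \<open>\<bar>x\<bar>\<close>, so it carries the minor inequality over.\<close>

lemma psd_on_two_point_power:
  assumes a: "psd_on {i, j} a"
    and f: "\<And>x. \<bar>f x\<bar> = \<bar>x\<bar> powr p" "\<And>x. 0 \<le> x \<Longrightarrow> 0 \<le> f x" and p: "0 < p"
  shows "psd_on {i, j} (\<lambda>i j. f (a i j))"
proof (rule psd_on_two_point_set)
  have diag: "0 \<le> a i i" "0 \<le> a j j"
    using psd_on_diag[OF a] by simp_all
  then show "0 \<le> f (a i i)" "0 \<le> f (a j j)"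
    using f by simp_all
  show "f (a i j) = f (a j i)"
    using psd_on_sym[OF a, of i j] by simp
  have "(f (a i j))\<^sup>2 = ((a i j)\<^sup>2) powr p"
    using f(1)[of "a i j"]
    by (metis abs_mult_self_eq power2_abs power2_eq_square powr_mult)
  also have "\<dots> \<le> (a i i * a j j) powr p"
    using psd_on_minor[OF a, of i j] p by (intro powr_mono2) auto
  also have "\<dots> = \<bar>f (a i i)\<bar> * \<bar>f (a j j)\<bar>"
    using diag by (simp add: f(1) powr_mult)
  also have "\<dots> = f (a i i) * f (a j j)"
    using diag f(2) by simp
  finally show "(f (a i j))\<^sup>2 \<le> f (a i i) * f (a j j)" .
qed

lemma set_card_le_two:
  assumes "finite I" "card I \<le> 2" "I \<noteq> {}"
  shows "\<exists>i j. I = {i, j}"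
proof -
  consider "card I = 1" | "card I = 2"
    using assms card_gt_0_iff[of I] by linarith
  then show ?thesis
  proof cases
    case 1
    then obtain i where "I = {i}" by (rule card_1_singletonE)
    then have "I = {i, i}" by simp
    then show ?thesis by blast
  qed (auto simp: card_2_iff)
qed

text \<open>The two functions share one induction because differentiation exchanges them. Each step
  removes one index and lowers the exponent by 1, ending at two points with an exponent that is
  still positive.\<close>

lemma psd_on_power:
  assumes "finite I" "card I \<le> n + 2" "real n \<le> p" "0 < p" "psd_on I a"
  shows "psd_on I (\<lambda>i j. phi p (a i j)) \<and> psd_on I (\<lambda>i j. psi p (a i j))"
  using assms
proof (induction n arbitrary: I p a)
  case 0
  show ?case
  proof (cases "I = {}")
    case False
    have "card I \<le> 2" using 0(2) by simp
    from set_card_le_two[OF 0(1) this False] obtain i j where I: "I = {i, j}"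
      by blast
    have a: "psd_on {i, j} a"
      using 0(5) by (simp add: I)
    have "\<bar>phi p x\<bar> = \<bar>x\<bar> powr p" "\<bar>psi p x\<bar> = \<bar>x\<bar> powr p"
      "0 \<le> x \<Longrightarrow> 0 \<le> phi p x" "0 \<le> x \<Longrightarrow> 0 \<le> psi p x" for x
      by (auto simp: phi_def psi_def sgn_if)
    then show ?thesis
      unfolding I
      using psd_on_two_point_power[OF a, of "phi p" p] psd_on_two_point_power[OF a, of "psi p" p]
        0(4) by simp
  qed (simp add: psd_on_def)
next
  case (Suc n)
  \<comment> \<open>Proved for every \<open>q > 1\<close>, not just for \<open>p\<close>, so that
    \<open>q\<close> can tend to 1 from the right.\<close>
  have step: "psd_on I (\<lambda>i j. phi q (a i j)) \<and> psd_on I (\<lambda>i j. psi q (a i j))"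
    if q: "1 < q" "real (Suc n) \<le> q" for q
  proof (cases "I = {}")
    case False
    then obtain k J where I: "I = insert k J" "k \<notin> J"
      by (metis all_not_in_conv mk_disjoint_insert)
    then have J: "finite J" "card J \<le> n + 2"
      using Suc.prems by auto
    have der: "psd_on J (\<lambda>i j. q * psi (q - 1) (b i j)) \<and> psd_on J (\<lambda>i j. q * phi (q - 1) (b i j))"
      if "psd_on J b" for b
      using Suc.IH[OF J, of "q - 1" b] that q by (auto intro: psd_on_scale)
    have a: "psd_on (insert k J) a"
      using Suc.prems I by simp
    have nonneg: "0 \<le> phi q x" "0 \<le> psi q x" if "0 \<le> x" for x
      using that by (simp_all add: phi_def psi_def)
    show ?thesis
      unfolding I
      using psd_on_insert_by_derivative[OF J(1) a phi_mult_divide nonneg(1) DERIV_phi[OF q(1)]]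
        psd_on_insert_by_derivative[OF J(1) a psi_mult_divide nonneg(2) DERIV_psi[OF q(1)]] der
      by simp
  qed (simp add: psd_on_def)
  show ?case
  proof (cases "1 < p")
    case True
    then show ?thesis using step Suc.prems by simp
  next
    case False
    \<comment> \<open>\<open>phi 1\<close> is not differentiable at 0, so the exponent 1 is reached as a limit from the right.\<close>
    then have p: "p = 1" "n = 0" using Suc.prems by auto
    have ev: "\<forall>\<^sub>F q in at_right (1::real). 1 < q \<and> real (Suc n) \<le> q"
      using eventually_at_right_less[of "1::real"] by (rule eventually_mono) (auto simp: p)
    have powr: "((\<lambda>q. \<bar>x\<bar> powr q) \<longlongrightarrow> \<bar>x\<bar> powr 1) (at_right 1)" for x :: real
      by (cases "x = 0") (simp, rule tendsto_powr[OF tendsto_const tendsto_ident_at], simp)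
    have "psd_on I (\<lambda>i j. phi 1 (a i j))"
      by (rule psd_on_limit[OF _ eventually_mono[OF ev]])
         (use step powr in \<open>auto simp: phi_def simp del: powr_one\<close>)
    \<comment> \<open>\<open>psi 1\<close> is the identity.\<close>
    moreover have "psd_on I (\<lambda>i j. psi 1 (a i j))"
      using Suc.prems(5) by (simp add: psi_def sgn_mult_abs)
    ultimately show ?thesis by (simp add: p)
  qed
qed

subsection \<open>Matrices\<close>

lemma psd_mats_iff:
  "A \<in> psd_mats n \<longleftrightarrow> A \<in> carrier_mat n n \<and> psd_on {..<n} (\<lambda>i j. A $$ (i, j))"
proof (cases "A \<in> carrier_mat n n")
  case A: True
  have sym: "transpose_mat A = A \<longleftrightarrow> (\<forall>i<n. \<forall>j<n. A $$ (i, j) = A $$ (j, i))"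
    using A by (auto simp: mat_eq_iff)
  have form: "scalar_prod v (A *\<^sub>v v) = (\<Sum>i<n. \<Sum>j<n. vec_index v i * vec_index v j * A $$ (i, j))"
    if "v \<in> carrier_vec n" for v
    using A that
    by (simp add: scalar_prod_def lessThan_atLeast0 sum_distrib_left algebra_simps)
  have "(\<forall>v\<in>carrier_vec n. 0 \<le> scalar_prod v (A *\<^sub>v v)) \<longleftrightarrow>
      (\<forall>x. 0 \<le> (\<Sum>i<n. \<Sum>j<n. x i * x j * A $$ (i, j)))" (is "?L \<longleftrightarrow> ?R")
  proof
    assume L: ?L
    show ?R
    proof
      fix x :: "nat \<Rightarrow> real"
      show "0 \<le> (\<Sum>i<n. \<Sum>j<n. x i * x j * A $$ (i, j))"
        using L[rule_format, of "Matrix.vec n x"] form[of "Matrix.vec n x"] by simp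
    qed
  qed (simp add: form)
  then show ?thesis
    using A sym by (simp add: psd_mats_def psd_on_def Ball_def lessThan_iff)
qed (simp add: psd_mats_def)

lemma map_mat_psd_mats:
  assumes "A \<in> psd_mats n" "n \<le> nat \<lfloor>p\<rfloor> + 2" "0 < p"
  shows "map_mat (phi p) A \<in> psd_mats n" "map_mat (psi p) A \<in> psd_mats n"
proof -
  have A: "A \<in> carrier_mat n n" and psd: "psd_on {..<n} (\<lambda>i j. A $$ (i, j))"
    using assms(1) by (auto simp: psd_mats_iff)
  have "real (nat \<lfloor>p\<rfloor>) \<le> p" using assms(3) by simp
  then have "psd_on {..<n} (\<lambda>i j. phi p (A $$ (i, j))) \<and> psd_on {..<n} (\<lambda>i j. psi p (A $$ (i, j)))"
    using psd_on_power[of "{..<n}" "nat \<lfloor>p\<rfloor>" p] psd assms by simp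
  then show "map_mat (phi p) A \<in> psd_mats n" "map_mat (psi p) A \<in> psd_mats n"
    using A psd_on_cong[of "{..<n}" "\<lambda>i j. phi p (A $$ (i, j))" "\<lambda>i j. map_mat (phi p) A $$ (i, j)"]
      psd_on_cong[of "{..<n}" "\<lambda>i j. psi p (A $$ (i, j))" "\<lambda>i j. map_mat (psi p) A $$ (i, j)"]
    by (auto simp: psd_mats_iff)
qed

lemma psd_mats_counterexample:
  assumes I: "finite I" "card I = n" and a: "psd_on I a" "\<not> psd_on I (\<lambda>i j. f (a i j))"
  shows "\<exists>A\<in>psd_mats n. map_mat f A \<notin> psd_mats n"
proof -
  obtain h where h: "bij_betw h {..<n} I"
    using I by (metis ex_bij_betw_nat_finite lessThan_atLeast0)
  define A where "A = Matrix.mat n n (\<lambda>(i, j). a (h i) (h j))"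
  \<comment> \<open>Used with \<open>g\<close> the identity for \<open>A\<close> itself and with
    \<open>g = f\<close> for its image.\<close>
  have psd: "psd_on {..<n} (\<lambda>i j. g (a (h i) (h j))) \<longleftrightarrow> psd_on I (\<lambda>i j. g (a i j))" for g
    by (rule psd_on_reindex[OF h])
  have "psd_on {..<n} (\<lambda>i j. A $$ (i, j))"
    using psd[of "\<lambda>x. x"] a(1) by (auto simp: A_def elim!: psd_on_cong)
  moreover have "\<not> psd_on {..<n} (\<lambda>i j. map_mat f A $$ (i, j))"
  proof
    assume "psd_on {..<n} (\<lambda>i j. map_mat f A $$ (i, j))"
    then have "psd_on {..<n} (\<lambda>i j. f (a (h i) (h j)))"
      by (rule psd_on_cong) (simp add: A_def)
    then show False using psd a(2) by simp
  qed
  ultimately show ?thesis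
    by (intro bexI[of _ A]) (auto simp: psd_mats_iff A_def)
qed

subsection \<open>Counterexamples\<close>

lemma psd_on_one_plus_product:
  fixes I :: "real set"
  assumes "0 \<le> e"
  shows "psd_on I (\<lambda>s t. 1 + e * (s * t))"
proof -
  have "psd_on I (\<lambda>_ _. 1)"
    using psd_on_rank_one[of 1 I "\<lambda>_. 1"] by simp
  moreover have "psd_on I (\<lambda>s t. e * (s * t))"
    using psd_on_scale[OF psd_on_rank_one[of 1 I "\<lambda>t. t"] assms] by simp
  ultimately show ?thesis
    by (rule psd_on_add)
qed

text \<open>The weight at \<open>t\<close> is the Lagrange basis polynomial of \<open>t\<close>
  evaluated at \<open>x\<close>: a polynomial of degree below \<open>card T\<close> equals its
  interpolant.\<close>

lemma interpolation_weights:
  fixes T :: "real set"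
  assumes T: "finite T"
  obtains w where "\<And>P. degree P < card T \<Longrightarrow> (\<Sum>t\<in>T. w t * poly P t) = poly P x"
proof
  fix P :: "real poly"
  assume deg: "degree P < card T"
  define L where
    "L t = smult (inverse (\<Prod>s\<in>T - {t}. t - s)) (\<Prod>s\<in>T - {t}. [:- s, 1:])" for t
  define Q where "Q = (\<Sum>t\<in>T. smult (poly P t) (L t))"
  have L: "poly (L t) s = (if s = t then 1 else 0)" if "s \<in> T" "t \<in> T" for s t
    using T that by (auto simp: L_def poly_prod field_simps)
  have "degree (smult (poly P t) (L t)) < card T" if "t \<in> T" for t
  proof -
    have "degree (\<Prod>s\<in>T - {t}. [:- s, 1:]) \<le> (\<Sum>s\<in>T - {t}. degree [:- s, 1:])"
      using degree_prod_sum_le[of "T - {t}" "\<lambda>s. [:- s, 1:]"] T by (simp add: comp_def)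
    also have "\<dots> < card T"
      using card_Diff1_less[OF T that] by simp
    finally show ?thesis
      unfolding L_def by (meson degree_smult_le le_less_trans)
  qed
  then have "degree Q < card T"
    unfolding Q_def using deg by (intro degree_sum_less) auto
  then have "P = Q"
    using deg T
    by (intro poly_eqI_degree[of T])
       (simp_all add: Q_def poly_sum L if_distrib[of "\<lambda>u. _ * u"] cong: if_cong)
  then have "poly P x = poly Q x"
    by (rule arg_cong)
  also have "\<dots> = (\<Sum>t\<in>T. poly P t * poly (L t) x)"
    by (simp add: Q_def poly_sum)
  \<comment> \<open>The weights are spelled out because \<open>L\<close> is local to the fixed
    \<open>P\<close>, while one \<open>w\<close> has to serve all polynomials.\<close>
  finally show "(\<Sum>t\<in>T. poly (smult (inverse (\<Prod>s\<in>T - {t}. t - s)) (\<Prod>s\<in>T - {t}. [:- s, 1:])) x * poly P t)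
      = poly P x"
    unfolding L_def[symmetric] by (simp add: mult.commute)
qed

text \<open>Of the factors \<open>p - i\<close> with \<open>i \<le> m + 1\<close>, only the last is
  negative.\<close>

lemma gbinomial_neg:
  fixes p :: real
  assumes "real m < p" "p < real (m + 1)"
  shows "p gchoose (m + 2) < 0"
proof -
  have "0 < (\<Prod>i = 0..<m + 1. p - real i)"
    using assms(1) by (intro prod_pos) auto
  then have "(\<Prod>i = 0..<m + 2. p - real i) < 0"
    using assms(2) by (simp add: mult_pos_neg)
  then show ?thesis
    by (simp add: gbinomial_prod_rev divide_neg_pos)
qed

text \<open>In the binomial expansion of the quadratic form of \<open>(1 + e s t) powr p\<close> all terms below
  order \<open>m + 2\<close> are killed by the choice of the vector, and the coefficient of order \<open>m + 2\<close> is
  negative.\<close>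

lemma counterexample_noninteger:
  fixes p :: real
  assumes p: "real m < p" "p < real (m + 1)"
  shows "\<exists>(I :: real set) a. finite I \<and> card I = m + 3 \<and> psd_on I a \<and>
    (\<forall>s\<in>I. \<forall>t\<in>I. 0 < a s t) \<and> \<not> psd_on I (\<lambda>s t. a s t powr p)"
proof -
  define T where "T = real ` {..m + 1}"
  define x where "x = real (m + 2)"
  define I where "I = insert x T"
  have T: "finite T" "card T = m + 2" "x \<notin> T"
    by (auto simp: T_def x_def card_image)
  then have I: "finite I" "card I = m + 3"
    by (auto simp: I_def)
  have I_bounds: "0 \<le> t" "t \<le> x" if "t \<in> I" for t
    using that by (auto simp: I_def T_def x_def)
  obtain w where w: "\<And>P. degree P < card T \<Longrightarrow> (\<Sum>t\<in>T. w t * poly P t) = poly P x"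
    using interpolation_weights[OF T(1)] by blast
  \<comment> \<open>\<open>v\<close> is the interpolation error at \<open>x\<close>; it annihilates
    all polynomials of degree below \<open>m + 2\<close>.\<close>
  define v where "v t = (if t = x then -1 else w t)" for t
  define S where "S k = (\<Sum>t\<in>I. v t * t ^ k)" for k
  have S: "S k = (\<Sum>t\<in>T. w t * t ^ k) - x ^ k" for k
  proof -
    have "(\<Sum>t\<in>T. v t * t ^ k) = (\<Sum>t\<in>T. w t * t ^ k)"
      using T(3) by (intro sum.cong) (auto simp: v_def)
    then show ?thesis
      using T by (simp add: S_def I_def v_def)
  qed
  have S_0: "S k = 0" if "k < m + 2" for k
    using w[of "monom 1 k"] that T(2) by (simp add: S poly_monom degree_monom_eq)
  have S_nz: "S (m + 2) \<noteq> 0"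
  proof -
    \<comment> \<open>The monic node polynomial. On \<open>T\<close> the power of order
      \<open>m + 2\<close> agrees with the lower-degree \<open>P\<close>, so the interpolation error
      is \<open>- poly R x\<close>, which is nonzero.\<close>
    define R where "R = (\<Prod>s\<in>T. [:- s, 1:])"
    have deg_R: "degree R = m + 2"
      using T(2) by (simp add: R_def degree_prod_eq_sum_degree)
    have "lead_coeff R = (\<Prod>s\<in>T. lead_coeff [:- s, 1:])"
      unfolding R_def by (rule lead_coeff_prod)
    then have R: "degree R = m + 2" "poly.coeff R (m + 2) = 1"
      using deg_R by simp_all
    define P where "P = monom 1 (m + 2) - R"
    have "degree P \<le> m + 2"
      unfolding P_def by (rule degree_diff_le) (simp_all add: R degree_monom_eq)
    moreover have "poly.coeff P (m + 2) = 0"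
      using R by (simp add: P_def)
    ultimately have "degree P < m + 2"
      using eq_zero_or_degree_less[of P "m + 2"] by auto
    then have "(\<Sum>t\<in>T. w t * poly P t) = poly P x"
      using w T(2) by simp
    moreover have "(\<Sum>t\<in>T. w t * poly P t) = (\<Sum>t\<in>T. w t * t ^ (m + 2))"
      using T(1) by (intro sum.cong) (auto simp: P_def R_def poly_monom poly_prod)
    ultimately have "S (m + 2) = - (\<Prod>s\<in>T. x - s)"
      by (simp add: S P_def R_def poly_monom poly_prod)
    then show ?thesis
      using T by auto
  qed
  \<comment> \<open>The form of the kernel \<open>(s * t) ^ k\<close> at \<open>v\<close> is the
    square of \<open>S k\<close>.\<close>
  define c where "c k = (p gchoose k) * (S k)\<^sup>2" for k
  define G where "G e = (\<Sum>s\<in>I. \<Sum>t\<in>I. v s * v t * (1 + e * (s * t)) powr p)" for e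
  have x: "0 < x" by (simp add: x_def)
  have G_sums: "(\<lambda>k. c k * e ^ k) sums G e" if e: "\<bar>e\<bar> < 1 / x\<^sup>2" for e
  proof -
    have "\<bar>e * (s * t)\<bar> < 1" if "s \<in> I" "t \<in> I" for s t
    proof -
      have "\<bar>e * (s * t)\<bar> \<le> \<bar>e\<bar> * x\<^sup>2"
        unfolding abs_mult power2_eq_square
        using I_bounds[OF that(1)] I_bounds[OF that(2)] by (intro mult_mono) auto
      also have "\<dots> < 1"
        using e x by (simp add: field_simps)
      finally show ?thesis .
    qed
    then have "(\<lambda>k. \<Sum>s\<in>I. \<Sum>t\<in>I. v s * v t * ((p gchoose k) * (e * (s * t)) ^ k)) sums G e"
      unfolding G_def by (intro sums_sum sums_mult gen_binomial_real) auto
    moreover have "(\<Sum>s\<in>I. \<Sum>t\<in>I. v s * v t * ((p gchoose k) * (e * (s * t)) ^ k)) = c k * e ^ k" for k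
      by (simp add: c_def S_def power2_eq_square sum_product sum_distrib_left sum_distrib_right
          power_mult_distrib mult_ac)
    ultimately show ?thesis by simp
  qed
  have "(\<lambda>k. c (k + (m + 2)) * e ^ k) sums (G e / e ^ (m + 2))" if "e \<noteq> 0" "norm e < 1 / x\<^sup>2" for e
  proof -
    have "(\<lambda>k. c (k + (m + 2)) * e ^ (k + (m + 2))) sums G e"
      using sums_split_initial_segment[OF G_sums[of e], of "m + 2"] that by (simp add: c_def S_0)
    from sums_divide[OF this, of "e ^ (m + 2)"] show ?thesis
      using that by (simp add: power_add)
  qed
  \<comment> \<open>The limit of the divided series is its constant term, the first surviving
    coefficient.\<close>
  then have "((\<lambda>e. G e / e ^ (m + 2)) \<longlongrightarrow> c (0 + (m + 2))) (at 0)"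
    using x by (intro powser_limit_0_strong[of "1 / x\<^sup>2"]) auto
  moreover have "c (0 + (m + 2)) < 0"
    using gbinomial_neg[OF p] S_nz by (simp add: c_def mult_neg_pos)
  ultimately have "\<forall>\<^sub>F e in at 0. G e / e ^ (m + 2) < 0"
    by (rule order_tendstoD(2))
  \<comment> \<open>Positive \<open>e\<close> are needed for the kernel itself to be positive
    semidefinite.\<close>
  then have "\<forall>\<^sub>F e in at_right 0. G e / e ^ (m + 2) < 0"
    by (rule filter_leD[OF at_le, rotated]) simp
  then obtain e where e: "0 < e" "G e / e ^ (m + 2) < 0"
    using eventually_happens'[OF trivial_limit_at_right_real
        eventually_conj[OF eventually_at_right_less[of "0::real"]]]
    by blast
  then have "G e < 0"
    using pos_divide_less_eq[of "e ^ (m + 2)" "G e" 0] by simp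
  then have "\<not> psd_on I (\<lambda>s t. (1 + e * (s * t)) powr p)"
    using psd_on_nonneg[of I "\<lambda>s t. (1 + e * (s * t)) powr p" v] by (auto simp: G_def)
  moreover have "0 < 1 + e * (s * t)" if "s \<in> I" "t \<in> I" for s t
    using I_bounds that e(1) by (simp add: add_pos_nonneg)
  ultimately show ?thesis
    using I psd_on_one_plus_product[of e I] e(1)
    by (intro exI[of _ I] exI[of _ "\<lambda>s t. 1 + e * (s * t)"]) auto
qed

text \<open>The entrywise \<open>m\<close>-th power of \<open>1 + s t\<close> has rank at most \<open>m + 1\<close>, so among \<open>m + 3\<close> nodes its
  kernel contains vectors with prescribed values at \<open>-2\<close> and \<open>1\<close>, the only two nodes with
  \<open>1 + s t < 0\<close>.\<close>

lemma counterexample_integer: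
  fixes f :: "real \<Rightarrow> real"
  assumes f: "\<And>x. 0 \<le> x \<Longrightarrow> f x = x ^ m" "f (-1) = - ((-1) ^ m)"
  shows "\<exists>(I :: real set) a. finite I \<and> card I = m + 3 \<and> psd_on I a \<and> \<not> psd_on I (\<lambda>s t. f (a s t))"
proof -
  \<comment> \<open>These nodes lie in the interval from 0 to 1/2, so \<open>1 + (-2) * t\<close>
    stays nonnegative on \<open>T\<close>.\<close>
  define T where "T = (\<lambda>i. 1 / (real i + 2)) ` {..m}"
  define I where "I = insert (-2) (insert 1 T)"
  have T_bounds: "0 \<le> t" "t \<le> 1 / 2" if "t \<in> T" for t
    using that by (auto simp: T_def field_simps)
  have T: "finite T" "card T = m + 1" "-2 \<notin> T" "1 \<notin> T"
  proof -
    have "inj_on (\<lambda>i. 1 / (real i + 2)) {..m}"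
      by (auto simp: inj_on_def field_simps)
    then show "card T = m + 1" by (simp add: T_def card_image)
    show "finite T" by (simp add: T_def)
    show "-2 \<notin> T" "1 \<notin> T" using T_bounds by force+
  qed
  then have I: "finite I" "card I = m + 3"
    by (auto simp: I_def)
  obtain w where w: "\<And>P. degree P < card T \<Longrightarrow> (\<Sum>t\<in>T. w t * poly P t) = poly P (-2)"
    using interpolation_weights[OF T(1)] by blast
  obtain u where u: "\<And>P. degree P < card T \<Longrightarrow> (\<Sum>t\<in>T. u t * poly P t) = poly P 1"
    using interpolation_weights[OF T(1)] by blast
  \<comment> \<open>The values at -2 and 1 are prescribed; the interpolation weights complete them
    on \<open>T\<close> to a vector annihilating polynomials of degree at most \<open>m\<close>. The
    sign \<open>(-1) ^ m\<close> makes the cross terms negative.\<close>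
  define v where
    "v t = (if t = -2 then 1 else if t = 1 then (-1) ^ m else - w t - (-1) ^ m * u t)" for t
  have v: "(\<Sum>t\<in>I. v t * poly P t) = 0" if "degree P < card T" for P
  proof -
    have "(\<Sum>t\<in>T. v t * poly P t) = (\<Sum>t\<in>T. (- w t - (-1) ^ m * u t) * poly P t)"
      using T by (intro sum.cong) (auto simp: v_def)
    also have "\<dots> = - (\<Sum>t\<in>T. w t * poly P t) - (-1) ^ m * (\<Sum>t\<in>T. u t * poly P t)"
      unfolding sum_negf[symmetric] sum_distrib_left sum_subtractf[symmetric]
      by (intro sum.cong refl) (simp add: algebra_simps)
    finally show ?thesis
      using T w[OF that] u[OF that] by (simp add: I_def) (simp add: v_def)
  qed
  \<comment> \<open>For fixed \<open>s\<close> the summand is \<open>v t\<close> times a polynomial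
    in \<open>t\<close> of degree at most \<open>m\<close>, below the \<open>m + 1\<close> nodes of
    \<open>T\<close>.\<close>
  have power_0: "(\<Sum>t\<in>I. v t * (1 + s * t) ^ m) = 0" for s
  proof -
    have "degree ([:1, s:] ^ m) \<le> degree [:1, s:] * m"
      by (rule degree_power_le)
    also have "\<dots> \<le> 1 * m" by (intro mult_right_mono) auto
    finally have "degree ([:1, s:] ^ m) < card T" using T(2) by simp
    from v[OF this] show ?thesis by (simp add: mult.commute)
  qed
  \<comment> \<open>The deviation of \<open>f\<close> from the honest power; on \<open>I\<close> it
    survives only at the pair -2, 1.\<close>
  define d where "d s t = f (1 + s * t) - (1 + s * t) ^ m" for s t
  have d_0: "d s t = 0" if "0 \<le> 1 + s * t" for s t
    using f(1)[OF that] by (simp add: d_def)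
  have "0 \<le> 1 + s * t \<and> 0 \<le> 1 + t * s" if "s \<in> I" "t \<in> T" for s t
    using that T_bounds(1)[of t] T_bounds(2)[of t] T_bounds(1)[of s]
    by (auto simp: I_def mult_nonneg_nonneg add_nonneg_nonneg)
  then have dT: "d s t = 0" "d t s = 0" if "s \<in> I" "t \<in> T" for s t
    using d_0 that by blast+
  have "(\<Sum>s\<in>I. \<Sum>t\<in>I. v s * v t * f (1 + s * t))
      = (\<Sum>s\<in>I. v s * (\<Sum>t\<in>I. v t * (1 + s * t) ^ m)) + (\<Sum>s\<in>I. \<Sum>t\<in>I. v s * v t * d s t)"
    unfolding sum_distrib_left sum.distrib[symmetric]
    by (intro sum.cong refl) (simp add: d_def algebra_simps)
  also have "\<dots> = (\<Sum>s\<in>I. \<Sum>t\<in>I. v s * v t * d s t)"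
    by (simp add: power_0)
  also have "\<dots> = (\<Sum>s\<in>{-2, 1}. \<Sum>t\<in>{-2, 1}. v s * v t * d s t)"
  proof -
    have "(\<Sum>t\<in>I. v s * v t * d s t) = (\<Sum>t\<in>{-2, 1}. v s * v t * d s t)" if "s \<in> I" for s
      using dT(1)[OF that] I(1) by (intro sum.mono_neutral_right) (auto simp: I_def)
    then have "(\<Sum>s\<in>I. \<Sum>t\<in>I. v s * v t * d s t) = (\<Sum>s\<in>I. \<Sum>t\<in>{-2, 1}. v s * v t * d s t)"
      by simp
    also have "\<dots> = (\<Sum>s\<in>{-2, 1}. \<Sum>t\<in>{-2, 1}. v s * v t * d s t)"
      using dT(2) I(1) by (intro sum.mono_neutral_right) (auto simp: I_def)
    finally show ?thesis .
  qed
  \<comment> \<open>Each of the two off-diagonal terms equals -2, since the signs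
    \<open>(-1) ^ m\<close> cancel.\<close>
  also have "\<dots> = -4"
  proof -
    have "d (-2) (-2) = 0" "d 1 1 = 0" by (simp_all add: d_0)
    moreover have "d (-2) 1 = - 2 * (-1) ^ m" "d 1 (-2) = - 2 * (-1) ^ m"
      using f(2) by (simp_all add: d_def)
    moreover have "(-1) ^ m * (-1) ^ m = (1::real)"
      by (simp flip: power_mult_distrib)
    ultimately show ?thesis by (simp add: v_def)
  qed
  finally have "\<not> psd_on I (\<lambda>s t. f (1 + 1 * (s * t)))"
    using psd_on_nonneg[of I "\<lambda>s t. f (1 + s * t)" v] by auto
  then show ?thesis
    using I psd_on_one_plus_product[of 1 I]
    by (intro exI[of _ I] exI[of _ "\<lambda>s t. 1 + 1 * (s * t)"]) auto
qed

text \<open>An integer \<open>p = m\<close> is odd here, so \<open>phi p (-1) = 1\<close> has the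
  wrong sign for the power. For other \<open>p\<close> the witness has positive entries, where
  \<open>phi p\<close> is \<open>powr p\<close>.\<close>

lemma phi_counterexample:
  assumes p: "0 < p" "p \<notin> {2 * real k | k. k \<ge> 1}"
  shows "\<exists>A\<in>psd_mats (nat \<lfloor>p\<rfloor> + 3). map_mat (phi p) A \<notin> psd_mats (nat \<lfloor>p\<rfloor> + 3)"
proof -
  define m where "m = nat \<lfloor>p\<rfloor>"
  have m: "real m \<le> p" "p < real (m + 1)"
    using p(1) unfolding m_def by linarith+
  show ?thesis
  proof (cases "p = real m")
    case True
    have "odd m"
    proof
      assume "even m"
      then obtain k where "m = 2 * k" by blast
      then show False using p True by auto
    qed
    moreover have "0 < m" using p(1) True by simp
    ultimately have "phi p x = x ^ m" "phi p (-1) = - ((-1) ^ m)" if "0 \<le> x" for x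
      using that True by (auto simp: phi_def powr_realpow')
    then show ?thesis
      using counterexample_integer[of "phi p" m] psd_mats_counterexample unfolding m_def by blast
  next
    case False
    then obtain I :: "real set" and a where I: "finite I" "card I = m + 3" "psd_on I a"
      and pos: "\<And>s t. s \<in> I \<Longrightarrow> t \<in> I \<Longrightarrow> 0 < a s t"
      and not_psd: "\<not> psd_on I (\<lambda>s t. a s t powr p)"
      using counterexample_noninteger[of m p] m by force
    have "phi p (a s t) = a s t powr p" if "s \<in> I" "t \<in> I" for s t
      using pos[OF that] by (simp add: phi_def)
    then have "\<not> psd_on I (\<lambda>s t. phi p (a s t))"
      using not_psd psd_on_cong[of I "\<lambda>s t. phi p (a s t)" "\<lambda>s t. a s t powr p"] by blast
    from psd_mats_counterexample[OF I(1,2,3) this] show ?thesis by (simp add: m_def)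
  qed
qed

text \<open>Parity is reversed: an integer \<open>p = m\<close> is even here, and
  \<open>psi p (-1) = -1\<close> has the wrong sign.\<close>

lemma psi_counterexample:
  assumes p: "0 < p" "p \<notin> {-1 + 2 * real k | k. k \<ge> 1}"
  shows "\<exists>A\<in>psd_mats (nat \<lfloor>p\<rfloor> + 3). map_mat (psi p) A \<notin> psd_mats (nat \<lfloor>p\<rfloor> + 3)"
proof -
  define m where "m = nat \<lfloor>p\<rfloor>"
  have m: "real m \<le> p" "p < real (m + 1)"
    using p(1) unfolding m_def by linarith+
  show ?thesis
  proof (cases "p = real m")
    case True
    have "even m"
    proof (rule ccontr)
      assume "odd m"
      then obtain k where "m = 2 * k + 1" by (rule oddE)
      then have "p = -1 + 2 * real (k + 1)" using True by simp
      then show False using p(2) by (metis (mono_tags, lifting) le_add2 mem_Collect_eq)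
    qed
    \<comment> \<open>At \<open>m = 0\<close> the power formula would fail at 0, where
      \<open>psi\<close> vanishes but \<open>0 ^ 0 = 1\<close>.\<close>
    moreover have "0 < m" using p(1) True by simp
    ultimately have "psi p x = x ^ m" "psi p (-1) = - ((-1) ^ m)" if "0 \<le> x" for x
      using that True by (auto simp: psi_def sgn_if powr_realpow')
    then show ?thesis
      using counterexample_integer[of "psi p" m] psd_mats_counterexample unfolding m_def by blast
  next
    case False
    then obtain I :: "real set" and a where I: "finite I" "card I = m + 3" "psd_on I a"
      and pos: "\<And>s t. s \<in> I \<Longrightarrow> t \<in> I \<Longrightarrow> 0 < a s t"
      and not_psd: "\<not> psd_on I (\<lambda>s t. a s t powr p)"
      using counterexample_noninteger[of m p] m by force
    have "psi p (a s t) = a s t powr p" if "s \<in> I" "t \<in> I" for s t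
      using pos[OF that] by (simp add: psi_def)
    then have "\<not> psd_on I (\<lambda>s t. psi p (a s t))"
      using not_psd psd_on_cong[of I "\<lambda>s t. psi p (a s t)" "\<lambda>s t. a s t powr p"] by blast
    from psd_mats_counterexample[OF I(1,2,3) this] show ?thesis by (simp add: m_def)
  qed
qed

lemma is_least_psd_failure:
  assumes "\<exists>A\<in>psd_mats (N + 3). map_mat f A \<notin> psd_mats (N + 3)"
    and pres: "\<And>n A. A \<in> psd_mats n \<Longrightarrow> n \<le> N + 2 \<Longrightarrow> map_mat f A \<in> psd_mats n"
  shows "is_least (N + 3) {n. n \<ge> 1 \<and> (\<exists>A \<in> psd_mats n. map_mat f A \<notin> psd_mats n)}"
  unfolding is_least_def
proof (intro conjI ballI)
  show "N + 3 \<in> {n. n \<ge> 1 \<and> (\<exists>A \<in> psd_mats n. map_mat f A \<notin> psd_mats n)}"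
    using assms(1) by simp
  fix n assume "n \<in> {n. n \<ge> 1 \<and> (\<exists>A \<in> psd_mats n. map_mat f A \<notin> psd_mats n)}"
  then obtain A where "A \<in> psd_mats n" "map_mat f A \<notin> psd_mats n" by blast
  then have "\<not> n \<le> N + 2" using pres by blast
  then show "N + 3 \<le> n" by simp
qed

theorem mainTheorem3:
  shows "(\<forall>p::real. p > 0 \<and> p \<notin> {2 * real k | k. k \<ge> 1} \<longrightarrow>
           is_least (nat \<lfloor>p\<rfloor> + 3)
             {n. n \<ge> 1 \<and> (\<exists>A \<in> psd_mats n. map_mat (phi p) A \<notin> psd_mats n)})
       \<and> (\<forall>p::real. p > 0 \<and> p \<notin> {-1 + 2 * real k | k. k \<ge> 1} \<longrightarrow>
           is_least (nat \<lfloor>p\<rfloor> + 3)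
             {n. n \<ge> 1 \<and> (\<exists>A \<in> psd_mats n. map_mat (psi p) A \<notin> psd_mats n)})"
proof (intro conjI allI impI)
  fix p :: real
  assume "p > 0 \<and> p \<notin> {2 * real k | k. k \<ge> 1}"
  then have p: "0 < p" "p \<notin> {2 * real k | k. k \<ge> 1}" by blast+
  show "is_least (nat \<lfloor>p\<rfloor> + 3)
      {n. n \<ge> 1 \<and> (\<exists>A \<in> psd_mats n. map_mat (phi p) A \<notin> psd_mats n)}"
    by (rule is_least_psd_failure[OF phi_counterexample[OF p] map_mat_psd_mats(1)[OF _ _ p(1)]])
next
  fix p :: real
  assume "p > 0 \<and> p \<notin> {-1 + 2 * real k | k. k \<ge> 1}"
  then have p: "0 < p" "p \<notin> {-1 + 2 * real k | k. k \<ge> 1}" by blast+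
  show "is_least (nat \<lfloor>p\<rfloor> + 3)
      {n. n \<ge> 1 \<and> (\<exists>A \<in> psd_mats n. map_mat (psi p) A \<notin> psd_mats n)}"
    by (rule is_least_psd_failure[OF psi_counterexample[OF p] map_mat_psd_mats(2)[OF _ _ p(1)]])
qed

end
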